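(* Let $\mathcal A(\mathbb R^n)$ be an algebra with mean value, with associated compact space $\mathcal K$ and probability measure $\mathfrak m$, and let $\psi\in\mathcal A(\mathbb R^n)$ be such that $\partial_{x_i}\psi,\ \partial^2_{x_ix_j}\psi\in\mathcal A(\mathbb R^n)$ for $i,j=1,\dots,n$. (i) If $\alpha\in\mathbb R$ is a strongly regular value of $\psi$, then $$\mathfrak m\left(\{z\in\mathcal K:\psi(z)=\alpha\}\right)=0.$$ (ii) If $$\mathfrak m\left(\{z\in\mathcal K:|\nabla\psi(z)|=0\}\right)=0,$$ then $\mathfrak m(\{z\in\mathcal K:\psi(z)=\alpha\})=0$ for all $\alpha\in\mathbb R$. In particular, this is the case if $0$ is a strongly regular value of $\partial_{x_k}\psi$ for some $k\in\{1,\dots,n\}$.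
   Context: $\mathrm{BUC}(\mathbb R^n)$ is the space of bounded uniformly continuous real functions on $\mathbb R^n$ with the sup norm. $g\in L^1_{\rm loc}(\mathbb R^n)$ has mean value $M(g)$ if $\lim_{\varepsilon\to0}\int_A g(x/\varepsilon)\,dx=|A|M(g)$ for every bounded Lebesgue measurable $A\subseteq\mathbb R^n$. An algebra with mean value is a linear subspace $\mathcal A=\mathcal A(\mathbb R^n)$ of $\mathrm{BUC}(\mathbb R^n)$ closed under products, invariant under all translations, closed in the sup norm, containing the constant function $1$, and each element of which has a mean value. Associated with $\mathcal A$ there are a compact Hausdorff space $\mathcal K$ and an isometric algebra isomorphism $\mathcal A\cong C(\mathcal K)$ (so $\mathcal K$ is the spectrum of $\mathcal A$), and a Radon probability measure $\mathfrak m$ on $\mathcal K$ with $\int_{\mathcal K}f\,d\mathfrak m=M(f)$ for $f\in\mathcal A$. The same symbol denotes an element of $\mathcal A$ and the corresponding continuous function on $\mathcal K$; $|\nabla\psi|=(\sum_i(\partial_{x_i}\psi)^2)^{1/2}\in\mathcal A$ is viewed in this way as a function on $\mathcal K$. For a $C^1$ function $\psi\in\mathcal A$ with $\partial_{x_i}\psi\in\mathcal A$, $i=1,\dots,n$, a number $\alpha\in\mathbb R$ is a strongly regular value of $\psi$ if there is $\delta_\alpha>0$ such that $|\psi(x)-\alpha|^2+|\nabla\psi(x)|^2>\delta_\alpha$ for all $x\in\mathbb R^n$. *)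

theory Defs
  imports "HOL-Analysis.Analysis" "HOL-Probability.Probability"
begin

definition BUC :: "(real^'n \<Rightarrow> real) set" where
  "BUC = {f. bounded (range f) \<and> uniformly_continuous_on UNIV f}"

definition locally_integrable :: "(real^'n \<Rightarrow> real) \<Rightarrow> bool" where
  "locally_integrable g \<longleftrightarrow> (\<forall>C. compact C \<longrightarrow> set_integrable lebesgue C g)"

definition has_mean_value :: "(real^'n \<Rightarrow> real) \<Rightarrow> real \<Rightarrow> bool" where
  "has_mean_value g c \<longleftrightarrow> locally_integrable g \<and>
     (\<forall>S. bounded S \<and> S \<in> sets lebesgue \<longrightarrow>
        ((\<lambda>\<epsilon>. LINT x:S|lebesgue. g (x /\<^sub>R \<epsilon>)) \<longlongrightarrow> measure lebesgue S * c) (at_right 0))"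

definition mean_value :: "(real^'n \<Rightarrow> real) \<Rightarrow> real" where
  "mean_value g = (THE c. has_mean_value g c)"

definition algebra_with_mean_value :: "(real^'n \<Rightarrow> real) set \<Rightarrow> bool" where
  "algebra_with_mean_value A \<longleftrightarrow>
     A \<subseteq> BUC \<and>
     (\<lambda>x. 1) \<in> A \<and>
     (\<forall>f\<in>A. \<forall>g\<in>A. \<forall>a b. (\<lambda>x. a * f x + b * g x) \<in> A) \<and>
     (\<forall>f\<in>A. \<forall>g\<in>A. (\<lambda>x. f x * g x) \<in> A) \<and>
     (\<forall>f\<in>A. \<forall>y. (\<lambda>x. f (x + y)) \<in> A) \<and>
     (\<forall>F f. (\<forall>k::nat. F k \<in> A) \<and> uniform_limit UNIV F f sequentially \<longrightarrow> f \<in> A) \<and>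
     (\<forall>f\<in>A. \<exists>c. has_mean_value f c)"

text \<open>Functions on a space \<open>X :: 'k topology\<close> are total on \<open>'k\<close>; extensionality
  selects one representative for each function on \<^term>\<open>topspace X\<close>.\<close>

definition continuous_functions :: "'k topology \<Rightarrow> ('k \<Rightarrow> real) set" where
  "continuous_functions X = {h. continuous_map X euclideanreal h} \<inter> extensional (topspace X)"

definition isometric_algebra_iso ::
    "(real^'n \<Rightarrow> real) set \<Rightarrow> 'k topology \<Rightarrow> ((real^'n \<Rightarrow> real) \<Rightarrow> 'k \<Rightarrow> real) \<Rightarrow> bool" where
  "isometric_algebra_iso A X \<Phi> \<longleftrightarrow>
     bij_betw \<Phi> A (continuous_functions X) \<and>
     (\<forall>f\<in>A. \<forall>g\<in>A. \<forall>a b. \<forall>z\<in>topspace X. \<Phi> (\<lambda>x. a * f x + b * g x) z = a * \<Phi> f z + b * \<Phi> g z) \<and>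
     (\<forall>f\<in>A. \<forall>g\<in>A. \<forall>z\<in>topspace X. \<Phi> (\<lambda>x. f x * g x) z = \<Phi> f z * \<Phi> g z) \<and>
     (\<forall>f\<in>A. (SUP z\<in>topspace X. \<bar>\<Phi> f z\<bar>) = (SUP x. \<bar>f x\<bar>))"

definition radon_probability_measure :: "'k topology \<Rightarrow> 'k measure \<Rightarrow> bool" where
  "radon_probability_measure X m \<longleftrightarrow>
     prob_space m \<and>
     space m = topspace X \<and>
     sets m = sigma_sets (topspace X) {U. openin X U} \<and>
     (\<forall>B\<in>sets m. emeasure m B = (SUP C\<in>{C. compactin X C \<and> C \<in> sets m \<and> C \<subseteq> B}. emeasure m C))"

text \<open>\<open>\<Phi> f\<close> is the continuous function on the compact space that corresponds to \<open>f \<in> A\<close>.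
  The space is determined by \<open>A\<close> up to homeomorphism only, so it is kept as a parameter.\<close>

definition associated_space ::
    "(real^'n \<Rightarrow> real) set \<Rightarrow> 'k topology \<Rightarrow> ((real^'n \<Rightarrow> real) \<Rightarrow> 'k \<Rightarrow> real) \<Rightarrow> 'k measure \<Rightarrow> bool" where
  "associated_space A X \<Phi> m \<longleftrightarrow>
     compact_space X \<and> Hausdorff_space X \<and>
     isometric_algebra_iso A X \<Phi> \<and>
     radon_probability_measure X m \<and>
     (\<forall>f\<in>A. (LINT z|m. \<Phi> f z) = mean_value f)"

definition partially_differentiable :: "'n \<Rightarrow> (real^'n \<Rightarrow> real) \<Rightarrow> bool" where
  "partially_differentiable i f \<longleftrightarrow>
     (\<forall>x. (\<lambda>t. f (x + t *\<^sub>R axis i 1)) differentiable at 0)"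

definition partial :: "'n \<Rightarrow> (real^'n \<Rightarrow> real) \<Rightarrow> real^'n \<Rightarrow> real" where
  "partial i f x = deriv (\<lambda>t. f (x + t *\<^sub>R axis i 1)) 0"

definition grad_norm :: "(real^'n \<Rightarrow> real) \<Rightarrow> real^'n \<Rightarrow> real" where
  "grad_norm f x = sqrt (\<Sum>i\<in>UNIV. (partial i f x)\<^sup>2)"

definition strongly_regular_value :: "(real^'n \<Rightarrow> real) \<Rightarrow> real \<Rightarrow> bool" where
  "strongly_regular_value f \<alpha> \<longleftrightarrow>
     (\<exists>\<delta>>0. \<forall>x. \<bar>f x - \<alpha>\<bar>\<^sup>2 + (grad_norm f x)\<^sup>2 > \<delta>)"

end

theory Submission imports Defs begin

text \<open>
  The mean value is translation invariant and continuous for the sup norm, and difference quotients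
  converge uniformly to a derivative lying in \<open>A\<close>; hence a derivative \<open>\<partial>h \<in> A\<close> of \<open>h \<in> A\<close> has mean value \<open>0\<close>.
  Let \<open>f, \<partial>f \<in> A\<close>, let \<open>q\<close> be a difference quotient of \<open>f\<close>, and apply this to
  \<open>h = \<delta> arctan ((f - \<alpha>) / \<delta>) q\<close>. As \<open>\<delta> \<rightarrow> 0\<close> the term \<open>\<delta> arctan (\<dots>) \<partial>q\<close> vanishes, while the
  derivative of the arctangent factor tends to \<open>\<partial>f\<close> times the indicator of \<open>{f = \<alpha>}\<close>, so the integral of
  \<open>\<partial>f q\<close> over \<open>{f = \<alpha>}\<close> is \<open>0\<close>. Letting \<open>q \<rightarrow> \<partial>f\<close> gives \<open>\<partial>f = 0\<close> almost everywhere on \<open>{f = \<alpha>}\<close>.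
  Only first derivatives of \<open>f\<close> enter, so the argument also applies to \<open>f = \<partial>\<^sub>k\<psi>\<close>.
\<close>

section \<open>Translation invariance of the mean value\<close>

text \<open>Both the unit cube and its translate by \<open>v\<close> lie in a cube \<open>B\<close>
  of side \<open>1 + 2 * norm v\<close>. Passing from either to \<open>B\<close> changes the
  integral by at most \<open>C\<close> times the excess volume, and the two errors add up to the
  factor 2.\<close>

lemma integral_unit_cbox_translate_bound:
  fixes h :: "'a::euclidean_space \<Rightarrow> real"
  assumes cont: "continuous_on UNIV h" and bound: "\<And>x. \<bar>h x\<bar> \<le> C"
  shows "\<bar>integral (cbox 0 One) (\<lambda>x. h (x + v)) - integral (cbox 0 One) h\<bar>
           \<le> 2 * C * ((1 + 2 * norm v) ^ DIM('a) - 1)"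
proof -
  define r where "r = norm v"
  define B :: "'a set" where "B = cbox (- r *\<^sub>R One) (- r *\<^sub>R One + (1 + 2 * r) *\<^sub>R One)"
  have r: "r \<ge> 0" by (simp add: r_def)
  have cB: "measure lborel B = (1 + 2 * r) ^ DIM('a)"
    unfolding B_def by (subst content_cbox_plus) (use r in auto)
  have int: "g integrable_on cbox a b" if "continuous_on UNIV g" for g :: "'a \<Rightarrow> real" and a b
    using integrable_continuous[OF continuous_on_subset[OF that]] by auto
  have comp: "\<bar>integral B h - integral (cbox w (One + w)) h\<bar> \<le> C * (measure lborel B - 1)"
    if "norm w \<le> r" for w :: 'a
  proof -
    have "\<bar>w \<bullet> b\<bar> \<le> r" if "b \<in> Basis" for b
      using Basis_le_norm[OF that, of w] \<open>norm w \<le> r\<close> by linarith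
    then have wb: "- r \<le> w \<bullet> b" "w \<bullet> b \<le> r" if "b \<in> Basis" for b
      using that by (force simp: abs_le_iff)+
    have sub: "cbox w (One + w) \<subseteq> B"
    proof
      fix x assume x: "x \<in> cbox w (One + w)"
      have "- r \<le> x \<bullet> b \<and> x \<bullet> b \<le> - r + (1 + 2 * r)" if b: "b \<in> Basis" for b
      proof -
        have "w \<bullet> b \<le> x \<bullet> b" "x \<bullet> b \<le> 1 + w \<bullet> b"
          using x b by (auto simp: mem_box inner_simps)
        with wb[OF b] show ?thesis by linarith
      qed
      then show "x \<in> B"
        by (auto simp: B_def mem_box inner_simps)
    qed
    have c1: "measure lborel (cbox w (One + w)) = 1"
      using content_cbox_plus[of w 1] by (simp add: add.commute)
    \<comment> \<open>The sign \<open>s\<close> covers both directions of the absolute value. Adding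
      \<open>C\<close> makes \<open>s * h + C\<close> nonnegative, so that its integral grows with
      the domain.\<close>
    have "s * integral (cbox w (One + w)) h + C \<le> s * integral B h + C * measure lborel B"
      if s: "s \<in> {-1, 1}" for s
    proof -
      have c: "continuous_on UNIV (\<lambda>x. s * h x + C)"
        by (intro continuous_intros cont)
      have "integral (cbox w (One + w)) (\<lambda>x. s * h x + C) \<le> integral B (\<lambda>x. s * h x + C)"
      proof (rule integral_subset_le[OF sub])
        show "(\<lambda>x. s * h x + C) integrable_on cbox w (One + w)" "(\<lambda>x. s * h x + C) integrable_on B"
          unfolding B_def by (rule int[OF c])+
        have "0 \<le> s * h x + C" for x
          using bound[of x] s by auto
        then show "\<forall>x\<in>B. 0 \<le> s * h x + C" by blast
      qed
      moreover have "integral (cbox a b) (\<lambda>x. s * h x + C)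
          = s * integral (cbox a b) h + C * measure lborel (cbox a b)" for a b
        by (subst integral_add) (auto intro!: int continuous_intros cont)
      ultimately show ?thesis
        unfolding B_def by (simp only: c1 mult_1_right)
    qed
    from this[of 1] this[of "-1"] show ?thesis by (simp add: algebra_simps abs_le_iff)
  qed
  have "integral (cbox 0 One) (\<lambda>x. h (x + v)) = integral (cbox v (One + v)) h"
    using integral_shift_cbox_plus[of 0 One h v] by (simp add: o_def add.commute)
  moreover have "\<bar>integral B h - integral (cbox v (One + v)) h\<bar> \<le> C * (measure lborel B - 1)"
    "\<bar>integral B h - integral (cbox 0 One) h\<bar> \<le> C * (measure lborel B - 1)"
    using comp[of v] comp[of 0] r by (simp_all add: r_def)
  ultimately show ?thesis
    unfolding cB r_def by linarith
qed

text \<open>A test set of measure 1 isolates the constant. This gives uniqueness, on which the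
  \<open>THE\<close> in \<open>mean_value\<close> depends, and later translation invariance.\<close>

lemma has_mean_value_unit_cbox:
  fixes g :: "real^'n \<Rightarrow> real"
  assumes "has_mean_value g c"
  shows "((\<lambda>\<epsilon>. LINT x:cbox 0 One|lebesgue. g (x /\<^sub>R \<epsilon>)) \<longlongrightarrow> c) (at_right 0)"
proof -
  let ?S = "cbox 0 One :: (real^'n) set"
  have "bounded ?S \<and> ?S \<in> sets lebesgue"
    by (simp add: bounded_cbox)
  then have "((\<lambda>\<epsilon>. LINT x:?S|lebesgue. g (x /\<^sub>R \<epsilon>)) \<longlongrightarrow> measure lebesgue ?S * c) (at_right 0)"
    using assms unfolding has_mean_value_def by blast
  moreover have "measure lebesgue ?S = 1"
    using content_cbox_plus[of "0 :: real^'n" 1] by simp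
  ultimately show ?thesis by simp
qed

lemma has_mean_value_unique:
  assumes "has_mean_value g c" "has_mean_value g d"
  shows "c = d"
  using tendsto_unique[OF _ has_mean_value_unit_cbox[OF assms(1)] has_mean_value_unit_cbox[OF assms(2)]]
  by simp

lemma mean_value_eqI: "has_mean_value g c \<Longrightarrow> mean_value g = c"
  unfolding mean_value_def by (blast intro: has_mean_value_unique)

text \<open>Since \<open>x /\<^sub>R \<epsilon> + y = (x + \<epsilon> *\<^sub>R y) /\<^sub>R
  \<epsilon>\<close>, a translation by \<open>y\<close> becomes, after rescaling, a shift of the
  unit cube by \<open>\<epsilon> *\<^sub>R y\<close>. The sup bound \<open>C\<close> does not depend
  on \<epsilon>, so the effect of the shift tends to 0.\<close>

lemma has_mean_value_translate_eq:
  fixes g :: "real^'n \<Rightarrow> real"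
  assumes buc: "g \<in> BUC" and c: "has_mean_value g c" and d: "has_mean_value (\<lambda>x. g (x + y)) d"
  shows "d = c"
proof -
  let ?S = "cbox 0 One :: (real^'n) set"
  have cont: "continuous_on UNIV g"
    using buc by (auto simp: BUC_def uniformly_continuous_imp_continuous)
  obtain C where C: "\<And>x. \<bar>g x\<bar> \<le> C"
    using buc by (auto simp: BUC_def bounded_iff)
  \<comment> \<open>The translation bound is stated for the gauge integral, the mean value for the
    Lebesgue integral. They agree for continuous functions on the compact cube.\<close>
  have lim: "((\<lambda>\<epsilon>. integral ?S (\<lambda>x. u (x /\<^sub>R \<epsilon>))) \<longlongrightarrow> l) (at_right 0)"
    if u: "continuous_on UNIV u" and l: "has_mean_value u l" for u :: "real^'n \<Rightarrow> real" and l
  proof -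
    have "(LINT x:?S|lebesgue. u (x /\<^sub>R \<epsilon>)) = integral ?S (\<lambda>x. u (x /\<^sub>R \<epsilon>))" for \<epsilon> :: real
    proof (rule set_lebesgue_integral_eq_integral(2))
      have "continuous_on ?S (\<lambda>x. u (x /\<^sub>R \<epsilon>))"
        by (rule continuous_on_compose2[OF u]) (auto intro!: continuous_intros)
      then have "set_integrable lborel ?S (\<lambda>x. u (x /\<^sub>R \<epsilon>))"
        unfolding set_integrable_def using borel_integrable_compact[OF compact_cbox] by blast
      then show "set_integrable lebesgue ?S (\<lambda>x. u (x /\<^sub>R \<epsilon>))"
        unfolding set_integrable_def using integrable_completion borel_measurable_integrable by blast
    qed
    then show ?thesis using has_mean_value_unit_cbox[OF l] by simp
  qed
  have "((\<lambda>\<epsilon>. integral ?S (\<lambda>x. g (x /\<^sub>R \<epsilon> + y)) - integral ?S (\<lambda>x. g (x /\<^sub>R \<epsilon>))) \<longlongrightarrow> d - c)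
      (at_right 0)"
    by (intro tendsto_diff lim cont c d continuous_on_compose2[OF cont] continuous_intros
        lim[of "\<lambda>x. g (x + y)"]) auto
  moreover have "((\<lambda>\<epsilon>. integral ?S (\<lambda>x. g (x /\<^sub>R \<epsilon> + y)) - integral ?S (\<lambda>x. g (x /\<^sub>R \<epsilon>))) \<longlongrightarrow> 0)
      (at_right 0)"
  proof (rule Lim_null_comparison)
    show "\<forall>\<^sub>F \<epsilon> in at_right 0.
        norm (integral ?S (\<lambda>x. g (x /\<^sub>R \<epsilon> + y)) - integral ?S (\<lambda>x. g (x /\<^sub>R \<epsilon>)))
          \<le> 2 * C * ((1 + 2 * norm (\<epsilon> *\<^sub>R y)) ^ DIM(real^'n) - 1)"
      using eventually_at_right_less[of "0::real"]
    proof eventually_elim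
      case (elim \<epsilon>)
      have "continuous_on UNIV (\<lambda>x. g (x /\<^sub>R \<epsilon>))"
        by (rule continuous_on_compose2[OF cont]) (auto intro!: continuous_intros)
      from integral_unit_cbox_translate_bound[OF this C, of "\<epsilon> *\<^sub>R y"] show ?case
        using elim by (simp add: scaleR_add_right)
    qed
    have "((\<lambda>\<epsilon>. 2 * C * ((1 + 2 * norm (\<epsilon> *\<^sub>R y)) ^ DIM(real^'n) - 1))
        \<longlongrightarrow> 2 * C * ((1 + 2 * norm (0 *\<^sub>R y)) ^ DIM(real^'n) - 1)) (at_right 0)"
      by (intro tendsto_intros)
    then show "((\<lambda>\<epsilon>. 2 * C * ((1 + 2 * norm (\<epsilon> *\<^sub>R y)) ^ DIM(real^'n) - 1)) \<longlongrightarrow> 0) (at_right 0)"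
      by simp
  qed
  ultimately have "d - c = 0"
    by (rule tendsto_unique[rotated]) simp
  then show ?thesis by simp
qed

section \<open>Difference quotients along a fixed direction\<close>

lemma line_derivative_everywhere:
  fixes h :: "'a::real_normed_vector \<Rightarrow> real"
  assumes "\<And>x. ((\<lambda>t. h (x + t *\<^sub>R e)) has_real_derivative h' x) (at 0)"
  shows "((\<lambda>t. h (x + t *\<^sub>R e)) has_real_derivative h' (x + s *\<^sub>R e)) (at s)"
  using assms[of "x + s *\<^sub>R e"] DERIV_at_within_shift[of "\<lambda>t. h (x + t *\<^sub>R e)" "h' (x + s *\<^sub>R e)" s 0 UNIV]
  by (simp add: scaleR_add_left add.assoc)

text \<open>By the mean value theorem the quotient is a value of \<open>h'\<close> on the segment
  from \<open>x\<close> to \<open>x + \<eta> *\<^sub>R e\<close>. Uniform continuity of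
  \<open>h'\<close> lets one step \<eta> serve all \<open>x\<close>.\<close>

lemma difference_quotient_uniform:
  fixes h :: "'a::real_normed_vector \<Rightarrow> real"
  assumes uc: "uniformly_continuous_on UNIV h'"
    and der: "\<And>x. ((\<lambda>t. h (x + t *\<^sub>R e)) has_real_derivative h' x) (at 0)"
    and "\<epsilon> > 0"
  obtains \<eta> where "\<eta> > 0" "\<And>x. \<bar>(h (x + \<eta> *\<^sub>R e) - h x) / \<eta> - h' x\<bar> \<le> \<epsilon>"
proof -
  obtain d where d: "d > 0" "\<And>x x'. dist x' x < d \<Longrightarrow> dist (h' x') (h' x) < \<epsilon>"
    using uc \<open>\<epsilon> > 0\<close> unfolding uniformly_continuous_on_def by auto
  \<comment> \<open>The summand 1 keeps the denominator positive when \<open>e = 0\<close> and makes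
    \<open>\<eta> * norm e < d\<close> strict.\<close>
  define \<eta> where "\<eta> = d / (norm e + 1)"
  have \<eta>: "\<eta> > 0" "\<eta> * norm e < d"
    using d(1) by (auto simp: \<eta>_def field_simps add_pos_nonneg)
  have "\<bar>(h (x + \<eta> *\<^sub>R e) - h x) / \<eta> - h' x\<bar> \<le> \<epsilon>" for x
  proof -
    obtain z where z: "0 < z" "z < \<eta>"
      "h (x + \<eta> *\<^sub>R e) - h (x + 0 *\<^sub>R e) = (\<eta> - 0) * h' (x + z *\<^sub>R e)"
      using MVT2[OF \<eta>(1), of "\<lambda>t. h (x + t *\<^sub>R e)" "\<lambda>t. h' (x + t *\<^sub>R e)"]
        line_derivative_everywhere[OF der] by blast
    have "dist (x + z *\<^sub>R e) x = z * norm e"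
      using z by (simp add: dist_norm)
    also have "\<dots> \<le> \<eta> * norm e"
      using z by (intro mult_right_mono) auto
    finally have "dist (h' (x + z *\<^sub>R e)) (h' x) < \<epsilon>"
      using \<eta>(2) by (intro d(2)) linarith
    with z \<eta>(1) show ?thesis by (simp add: dist_real_def)
  qed
  with \<eta>(1) that show ?thesis by blast
qed

lemma partially_differentiable_DERIV:
  assumes "partially_differentiable i f"
  shows "((\<lambda>t. f (x + t *\<^sub>R axis i 1)) has_real_derivative partial i f x) (at 0)"
  using assms unfolding partially_differentiable_def partial_def
  by (simp add: DERIV_deriv_iff_real_differentiable)

lemma grad_norm_square:
  "(grad_norm f x)\<^sup>2 = (\<Sum>i\<in>UNIV. (partial i f x)\<^sup>2)"
  by (simp add: grad_norm_def sum_nonneg)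

section \<open>The algebra and its representation on the compact space\<close>

locale associated_mean_value_space =
  fixes A :: "(real^'n \<Rightarrow> real) set"
    and X :: "'k topology"
    and \<Phi> :: "(real^'n \<Rightarrow> real) \<Rightarrow> 'k \<Rightarrow> real"
    and m :: "'k measure"
  assumes algebra: "algebra_with_mean_value A"
    and assoc: "associated_space A X \<Phi> m"
begin

lemma BUC_mem: "f \<in> A \<Longrightarrow> f \<in> BUC"
  and one_mem: "(\<lambda>x. 1) \<in> A"
  and lin_mem: "f \<in> A \<Longrightarrow> g \<in> A \<Longrightarrow> (\<lambda>x. a * f x + b * g x) \<in> A"
  and mult_mem: "f \<in> A \<Longrightarrow> g \<in> A \<Longrightarrow> (\<lambda>x. f x * g x) \<in> A"
  and translate_mem: "f \<in> A \<Longrightarrow> (\<lambda>x. f (x + y)) \<in> A"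
  and has_mean_value_mem: "f \<in> A \<Longrightarrow> \<exists>c. has_mean_value f c"
  using algebra unfolding algebra_with_mean_value_def by (elim conjE, auto)+

lemma limit_mem:
  assumes "\<And>k::nat. F k \<in> A" and "uniform_limit UNIV F h sequentially"
  shows "h \<in> A"
proof -
  have "\<forall>F f. (\<forall>k::nat. F k \<in> A) \<and> uniform_limit UNIV F f sequentially \<longrightarrow> f \<in> A"
    using algebra unfolding algebra_with_mean_value_def by (elim conjE)
  with assms show ?thesis by blast
qed

lemma add_mem: "f \<in> A \<Longrightarrow> g \<in> A \<Longrightarrow> (\<lambda>x. f x + g x) \<in> A"
  and diff_mem: "f \<in> A \<Longrightarrow> g \<in> A \<Longrightarrow> (\<lambda>x. f x - g x) \<in> A"
  and scale_mem: "f \<in> A \<Longrightarrow> (\<lambda>x. a * f x) \<in> A"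
  and const_mem: "(\<lambda>x. a) \<in> A"
  using lin_mem[of f g 1 1] lin_mem[of f g 1 "-1"] lin_mem[of f f a 0] lin_mem[OF one_mem one_mem, of a 0]
  by simp_all

lemma bounded_mem: "f \<in> A \<Longrightarrow> \<exists>C. \<forall>x. \<bar>f x\<bar> \<le> C"
  using BUC_mem[of f] by (auto simp: BUC_def bounded_iff)

lemma uniformly_continuous_mem: "f \<in> A \<Longrightarrow> uniformly_continuous_on UNIV f"
  using BUC_mem[of f] by (auto simp: BUC_def)

lemma iso: "isometric_algebra_iso A X \<Phi>" and radon: "radon_probability_measure X m"
  and compact_X: "compact_space X"
  and integral_eq_mean: "f \<in> A \<Longrightarrow> (LINT z|m. \<Phi> f z) = mean_value f"
  using assoc unfolding associated_space_def by auto

lemma space_m: "space m = topspace X" and sets_m: "sets m = sigma_sets (topspace X) {U. openin X U}"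
  using radon unfolding radon_probability_measure_def by auto

sublocale prob_space m
  using radon unfolding radon_probability_measure_def by auto

context
  fixes z assumes z: "z \<in> topspace X"
begin

lemma rep_lin: "f \<in> A \<Longrightarrow> g \<in> A \<Longrightarrow> \<Phi> (\<lambda>x. a * f x + b * g x) z = a * \<Phi> f z + b * \<Phi> g z"
  and rep_mult: "f \<in> A \<Longrightarrow> g \<in> A \<Longrightarrow> \<Phi> (\<lambda>x. f x * g x) z = \<Phi> f z * \<Phi> g z"
  using iso z unfolding isometric_algebra_iso_def by (elim conjE, simp)+

lemma rep_add: "f \<in> A \<Longrightarrow> g \<in> A \<Longrightarrow> \<Phi> (\<lambda>x. f x + g x) z = \<Phi> f z + \<Phi> g z"
  and rep_diff: "f \<in> A \<Longrightarrow> g \<in> A \<Longrightarrow> \<Phi> (\<lambda>x. f x - g x) z = \<Phi> f z - \<Phi> g z"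
  and rep_scale: "f \<in> A \<Longrightarrow> \<Phi> (\<lambda>x. a * f x) z = a * \<Phi> f z"
  using rep_lin[of f g 1 1] rep_lin[of f g 1 "-1"] rep_lin[of f f a 0] by simp_all

text \<open>Preservation of the unit follows from surjectivity: the constant 1 on the space,
  restricted so as to be extensional, is \<open>\<Phi> h\<close> for some \<open>h\<close>, and
  \<open>h = h * 1\<close> gives \<open>1 = 1 * \<Phi> (\<lambda>x. 1) z\<close>.\<close>

lemma rep_one: "\<Phi> (\<lambda>x. 1) z = 1"
proof -
  have "restrict (\<lambda>_. 1) (topspace X) \<in> continuous_functions X"
    by (auto simp: continuous_functions_def intro: continuous_map_eq[of _ _ "\<lambda>_. 1"])
  moreover have "continuous_functions X = \<Phi> ` A"
    using iso unfolding isometric_algebra_iso_def bij_betw_def by blast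
  ultimately obtain h where h: "h \<in> A" "\<Phi> h = restrict (\<lambda>_. 1) (topspace X)"
    by (metis (lifting) imageE)
  then show ?thesis
    using rep_mult[OF h(1) one_mem] z by simp
qed

lemma rep_const: "\<Phi> (\<lambda>x. a) z = a"
  using rep_scale[OF one_mem, of a] rep_one by simp

end

lemma rep_continuous: "f \<in> A \<Longrightarrow> continuous_map X euclideanreal (\<Phi> f)"
  using iso unfolding isometric_algebra_iso_def bij_betw_def continuous_functions_def by auto

lemma rep_bound:
  assumes f: "f \<in> A" and C: "\<And>x. \<bar>f x\<bar> \<le> C" and z: "z \<in> topspace X"
  shows "\<bar>\<Phi> f z\<bar> \<le> C"
proof -
  \<comment> \<open>Compactness bounds \<open>\<Phi> f\<close>, so the supremum in the isometry
    condition really is an upper bound of its values.\<close>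
  have "compactin euclideanreal (\<Phi> f ` topspace X)"
    using image_compactin compact_X rep_continuous[OF f] unfolding compact_space_def by blast
  then have "bounded (\<Phi> f ` topspace X)"
    by (simp add: compact_imp_bounded)
  then have bdd: "bdd_above ((\<lambda>z. \<bar>\<Phi> f z\<bar>) ` topspace X)"
    by (auto simp: bounded_iff bdd_above_def)
  have "\<bar>\<Phi> f z\<bar> \<le> (SUP z\<in>topspace X. \<bar>\<Phi> f z\<bar>)"
    by (rule cSUP_upper[OF z bdd])
  also have "\<dots> = (SUP x. \<bar>f x\<bar>)"
    using iso f unfolding isometric_algebra_iso_def by blast
  also have "\<dots> \<le> C"
    by (rule cSUP_least) (auto intro: C)
  finally show ?thesis .
qed

lemma rep_diff_bound:
  assumes "f \<in> A" "g \<in> A" "\<And>x. \<bar>f x - g x\<bar> \<le> C" "z \<in> topspace X"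
  shows "\<bar>\<Phi> f z - \<Phi> g z\<bar> \<le> C"
  using rep_bound[OF diff_mem[OF assms(1,2)] assms(3,4)] rep_diff[OF assms(4,1,2)] by simp

lemma rep_measurable: "f \<in> A \<Longrightarrow> \<Phi> f \<in> borel_measurable m"
proof (rule borel_measurableI)
  fix S :: "real set" assume "f \<in> A" "open S"
  then have "openin X {z \<in> topspace X. \<Phi> f z \<in> S}"
    using openin_continuous_map_preimage[OF rep_continuous] by auto
  moreover have "\<Phi> f -` S \<inter> space m = {z \<in> topspace X. \<Phi> f z \<in> S}"
    by (auto simp: space_m)
  ultimately show "\<Phi> f -` S \<inter> space m \<in> sets m"
    by (auto simp: sets_m)
qed

lemma level_set_sets:
  assumes "f \<in> A"
  shows "{z \<in> topspace X. \<Phi> f z = \<alpha>} \<in> sets m"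
proof -
  have "\<Phi> f -` {\<alpha>} \<inter> space m \<in> sets m"
    using rep_measurable[OF assms] by (rule measurable_sets) simp
  also have "\<Phi> f -` {\<alpha>} \<inter> space m = {z \<in> topspace X. \<Phi> f z = \<alpha>}"
    by (auto simp: space_m)
  finally show ?thesis .
qed

lemma rep_integrable:
  assumes "f \<in> A" shows "integrable m (\<Phi> f)"
proof -
  obtain C where "\<And>x. \<bar>f x\<bar> \<le> C" using bounded_mem[OF assms] by blast
  with rep_bound[OF assms] show ?thesis
    by (intro integrable_const_bound[of _ C] rep_measurable assms) (auto simp: space_m)
qed

section \<open>Continuous functional calculus\<close>

lemma rep_polynomial:
  assumes "real_polynomial_function p" and f: "f \<in> A"
  shows "(\<lambda>x. p (f x)) \<in> A \<and> (\<forall>z\<in>topspace X. \<Phi> (\<lambda>x. p (f x)) z = p (\<Phi> f z))"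
  using assms(1)
proof induction
  case (linear p)
  then obtain c where "p = (\<lambda>x. x * c)"
    by (auto simp: real_bounded_linear)
  then show ?case using scale_mem[OF f, of c] rep_scale[OF _ f, of _ c] by (simp add: mult.commute)
qed (auto simp: const_mem rep_const add_mem rep_add mult_mem rep_mult)

text \<open>An interval \<open>{-R..R}\<close> contains the values of \<open>f\<close> and, by
  isometry, those of \<open>\<Phi> f\<close>. Polynomials approximate \<open>F\<close> uniformly
  there; closedness of \<open>A\<close> then gives membership, and isometry carries the formula from
  polynomials to \<open>F\<close>.\<close>

lemma functional_calculus:
  assumes F: "continuous_on UNIV F" and f: "f \<in> A"
  shows functional_calculus_mem: "(\<lambda>x. F (f x)) \<in> A"
    and functional_calculus_rep: "z \<in> topspace X \<Longrightarrow> \<Phi> (\<lambda>x. F (f x)) z = F (\<Phi> f z)"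
proof -
  obtain R where R: "\<And>x. \<bar>f x\<bar> \<le> R" using bounded_mem[OF f] by blast
  have "\<exists>p. real_polynomial_function p \<and> (\<forall>x\<in>{-R..R}. \<bar>F x - p x\<bar> < 1 / real (Suc n))" for n
    using Stone_Weierstrass_real_polynomial_function[of "{-R..R}" F "1 / real (Suc n)"]
      continuous_on_subset[OF F] by (metis compact_Icc of_nat_0_less_iff subset_UNIV zero_less_Suc zero_less_divide_1_iff)
  then obtain p where p: "\<And>n. real_polynomial_function (p n)"
    "\<And>n x. x \<in> {-R..R} \<Longrightarrow> \<bar>F x - p n x\<bar> < 1 / real (Suc n)"
    by metis
  have pA: "(\<lambda>x. p n (f x)) \<in> A" for n
    using rep_polynomial[OF p(1) f] by blast
  have close: "\<bar>F (f x) - p n (f x)\<bar> < 1 / real (Suc n)" for x n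
    using R[of x] by (intro p(2)) (auto simp: abs_le_iff)
  have lim0: "(\<lambda>n. 1 / real (Suc n)) \<longlonglongrightarrow> 0"
    using LIMSEQ_inverse_real_of_nat by (simp add: inverse_eq_divide)
  have "uniform_limit UNIV (\<lambda>n x. p n (f x)) (\<lambda>x. F (f x)) sequentially"
  proof (rule uniform_limitI)
    fix e :: real assume "e > 0"
    from order_tendstoD(2)[OF lim0 this]
    show "\<forall>\<^sub>F n in sequentially. \<forall>x\<in>UNIV. dist (p n (f x)) (F (f x)) < e"
      by eventually_elim (use close in \<open>auto simp: dist_real_def abs_minus_commute intro: less_trans\<close>)
  qed
  with pA show mem: "(\<lambda>x. F (f x)) \<in> A"
    by (rule limit_mem)
  assume z: "z \<in> topspace X"
  have bound: "\<bar>\<Phi> (\<lambda>x. F (f x)) z - F (\<Phi> f z)\<bar> \<le> 2 * (1 / real (Suc n))" for n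
  proof -
    have "\<bar>\<Phi> (\<lambda>x. F (f x)) z - \<Phi> (\<lambda>x. p n (f x)) z\<bar> \<le> 1 / real (Suc n)"
      by (rule rep_diff_bound[OF mem pA _ z]) (use close in \<open>auto intro: less_imp_le\<close>)
    moreover have "\<Phi> (\<lambda>x. p n (f x)) z = p n (\<Phi> f z)"
      using rep_polynomial[OF p(1) f] z by blast
    moreover have "\<bar>F (\<Phi> f z) - p n (\<Phi> f z)\<bar> < 1 / real (Suc n)"
      using rep_bound[OF f R z] by (intro p(2)) (auto simp: abs_le_iff)
    ultimately show ?thesis by linarith
  qed
  have "(\<lambda>n. 2 * (1 / real (Suc n))) \<longlonglongrightarrow> 0"
    using tendsto_mult[OF tendsto_const lim0, of 2] by simp
  then have "\<bar>\<Phi> (\<lambda>x. F (f x)) z - F (\<Phi> f z)\<bar> \<le> 0"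
    by (rule LIMSEQ_le_const) (use bound in blast)
  then show "\<Phi> (\<lambda>x. F (f x)) z = F (\<Phi> f z)" by simp
qed

text \<open>Here \<open>f\<close> equals its absolute value, which the functional calculus carries
  over to \<open>\<Phi> f\<close>. This is how pointwise inequalities pass to the compact
  space.\<close>

lemma rep_nonneg:
  assumes f: "f \<in> A" and "\<And>x. f x \<ge> 0" and z: "z \<in> topspace X"
  shows "\<Phi> f z \<ge> 0"
proof -
  have "\<Phi> f z = \<bar>\<Phi> f z\<bar>"
    using functional_calculus_rep[OF _ f z, of abs] assms(2) by (simp add: continuous_intros)
  then show ?thesis by linarith
qed

section \<open>Integrals of derivatives and vanishing on level sets\<close>

lemma integral_translate:
  assumes f: "f \<in> A"
  shows "(LINT z|m. \<Phi> (\<lambda>x. f (x + y)) z) = (LINT z|m. \<Phi> f z)"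
proof -
  obtain c d where c: "has_mean_value f c" and d: "has_mean_value (\<lambda>x. f (x + y)) d"
    using has_mean_value_mem f translate_mem[OF f] by blast
  then show ?thesis
    using has_mean_value_translate_eq[OF BUC_mem[OF f] c d] integral_eq_mean f translate_mem[OF f, of y]
    by (simp add: mean_value_eqI)
qed

lemma difference_quotient_mem: "f \<in> A \<Longrightarrow> (\<lambda>x. (f (x + y) - f x) / \<eta>) \<in> A"
  using scale_mem[OF diff_mem[OF translate_mem], of f f "1 / \<eta>" y] by simp

text \<open>A difference quotient of \<open>h\<close> integrates to 0 by
  \<open>integral_translate\<close>. It is uniformly close to \<open>h'\<close>, hence so are the
  representatives, and \<open>m\<close> has total mass 1.\<close>

lemma integral_derivative_eq_0:
  assumes h: "h \<in> A" and h': "h' \<in> A"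
    and der: "\<And>x. ((\<lambda>t. h (x + t *\<^sub>R e)) has_real_derivative h' x) (at 0)"
  shows "(LINT z|m. \<Phi> h' z) = 0"
proof -
  have "\<bar>LINT z|m. \<Phi> h' z\<bar> \<le> \<epsilon>" if \<epsilon>: "\<epsilon> > 0" for \<epsilon>
  proof -
    obtain \<eta> where \<eta>: "\<eta> > 0" "\<And>x. \<bar>(h (x + \<eta> *\<^sub>R e) - h x) / \<eta> - h' x\<bar> \<le> \<epsilon>"
      using difference_quotient_uniform[OF uniformly_continuous_mem[OF h'] der \<epsilon>] by blast
    define q where "q = (\<lambda>x. (h (x + \<eta> *\<^sub>R e) - h x) / \<eta>)"
    have q: "q \<in> A" unfolding q_def by (rule difference_quotient_mem[OF h])
    have "\<Phi> q z = (\<Phi> (\<lambda>x. h (x + \<eta> *\<^sub>R e)) z - \<Phi> h z) / \<eta>" if "z \<in> topspace X" for z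
      using rep_scale[OF that diff_mem[OF translate_mem[OF h] h], of "1/\<eta>"]
        rep_diff[OF that translate_mem[OF h] h] by (simp add: q_def)
    then have "(LINT z|m. \<Phi> q z) = (LINT z|m. (\<Phi> (\<lambda>x. h (x + \<eta> *\<^sub>R e)) z - \<Phi> h z) / \<eta>)"
      by (intro Bochner_Integration.integral_cong) (auto simp: space_m)
    also have "\<dots> = 0"
      using integral_translate[OF h] rep_integrable[OF h] rep_integrable[OF translate_mem[OF h]] by simp
    finally have "(LINT z|m. \<Phi> h' z) = (LINT z|m. \<Phi> h' z - \<Phi> q z)"
      using rep_integrable[OF h'] rep_integrable[OF q] by simp
    also have "\<bar>\<dots>\<bar> \<le> (LINT z|m. \<bar>\<Phi> h' z - \<Phi> q z\<bar>)"
      by (rule integral_abs_bound)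
    also have "\<dots> \<le> \<epsilon>"
      using rep_diff_bound[OF h' q] \<eta>(2) rep_integrable[OF h'] rep_integrable[OF q]
      by (intro integral_le_const) (auto simp: space_m q_def abs_minus_commute)
    finally show ?thesis .
  qed
  then have "\<bar>LINT z|m. \<Phi> h' z\<bar> \<le> 0"
    by (rule field_le_epsilon[of _ 0, simplified])
  then show ?thesis by simp
qed

text \<open>On the level set \<open>g\<close> is orthogonal to every \<open>q\<close> in
  \<open>A\<close> whose derivative along \<open>e\<close> lies in \<open>A\<close>
  (\<open>orth\<close>). Such \<open>q\<close> approximate \<open>g\<close> uniformly, so the
  integral of the square of \<open>\<Phi> g\<close> over the level set is 0.\<close>

lemma derivative_zero_on_level_set:
  assumes f: "f \<in> A" and g: "g \<in> A"
    and der: "\<And>x. ((\<lambda>t. f (x + t *\<^sub>R e)) has_real_derivative g x) (at 0)"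
  shows "AE z in m. \<Phi> f z = \<alpha> \<longrightarrow> \<Phi> g z = 0"
proof -
  define I where "I = (\<lambda>z. indicator {z. \<Phi> f z = \<alpha>} z :: real)"
  have "{z. \<Phi> f z = \<alpha>} \<inter> space m = {z \<in> topspace X. \<Phi> f z = \<alpha>}"
    by (auto simp: space_m)
  then have I_meas: "I \<in> borel_measurable m"
    unfolding I_def using level_set_sets[OF f, of \<alpha>] by (simp add: borel_measurable_indicator_iff)
  obtain C where C: "\<And>x. \<bar>g x\<bar> \<le> C" using bounded_mem[OF g] by blast
  have C0: "0 \<le> C" using C[of 0] by linarith
  have I_int: "integrable m (\<lambda>z. I z * (\<Phi> u z * \<Phi> v z))" if "u \<in> A" "v \<in> A" for u v
  proof (rule Bochner_Integration.integrable_bound)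
    show "integrable m (\<Phi> (\<lambda>x. u x * v x))"
      by (intro rep_integrable mult_mem that)
    show "(\<lambda>z. I z * (\<Phi> u z * \<Phi> v z)) \<in> borel_measurable m"
      by (intro borel_measurable_times rep_measurable that I_meas)
    show "AE z in m. norm (I z * (\<Phi> u z * \<Phi> v z)) \<le> norm (\<Phi> (\<lambda>x. u x * v x) z)"
      using that by (auto simp: I_def indicator_def space_m rep_mult)
  qed
  have orth: "(LINT z|m. I z * (\<Phi> g z * \<Phi> q z)) = 0"
    if q: "q \<in> A" and q': "q' \<in> A"
      and q_der: "\<And>x. ((\<lambda>t. q (x + t *\<^sub>R e)) has_real_derivative q' x) (at 0)" for q q'
  proof -
    \<comment> \<open>\<open>w N\<close> is the derivative of \<open>F N\<close>, with scale
      \<delta> = 1 / (N + 1). While \<open>F N\<close> tends to 0 uniformly, \<open>w N\<close>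
      tends pointwise to the indicator of \<alpha> and stays between 0 and 1.\<close>
    define w where "w = (\<lambda>N s. 1 / (1 + (real (Suc N) * (s - \<alpha>))\<^sup>2))"
    define F where "F = (\<lambda>N s. arctan (real (Suc N) * (s - \<alpha>)) / real (Suc N))"
    have w_cont: "continuous_on UNIV (w N)" for N
      unfolding w_def by (intro continuous_intros) (auto simp: add_nonneg_eq_0_iff)
    have F_cont: "continuous_on UNIV (F N)" for N
      unfolding F_def by (intro continuous_intros) auto
    note wA = functional_calculus_mem[OF w_cont f] and FA = functional_calculus_mem[OF F_cont f]
    have F_bound: "\<bar>F N s\<bar> \<le> 2 / real (Suc N)" for N s
      using arctan_bounded[of "real (Suc N) * (s - \<alpha>)"] pi_less_4
      unfolding F_def by (auto simp: abs_le_iff divide_simps)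
    have w_bound: "0 \<le> w N s" "w N s \<le> 1" for N s
      by (auto simp: w_def divide_le_eq_1 add_pos_nonneg)
    have w_lim: "(\<lambda>N. w N s) \<longlonglongrightarrow> indicator {\<alpha>} s" for s
    proof (cases "s = \<alpha>")
      case False
      \<comment> \<open>Used with \<open>j\<close> the square of 1 / (N + 1) and \<open>d\<close>
        the square of s - \<alpha>: the quotient then has a limit with nonzero denominator as
        \<open>j\<close> tends to 0.\<close>
      have frac: "1 / (1 + d / j) = j / (j + d)" if "j > 0" for d j :: real
        using that by (simp add: field_simps)
      have "w N s = (inverse (real (Suc N)))\<^sup>2 / ((inverse (real (Suc N)))\<^sup>2 + (s - \<alpha>)\<^sup>2)" for N
      proof -
        have "(real (Suc N) * (s - \<alpha>))\<^sup>2 = (s - \<alpha>)\<^sup>2 / (inverse (real (Suc N)))\<^sup>2"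
          by (simp add: power_mult_distrib power_inverse divide_inverse mult.commute)
        moreover have "(inverse (real (Suc N)))\<^sup>2 > 0" by simp
        ultimately show ?thesis
          unfolding w_def using frac by simp
      qed
      moreover have "(\<lambda>N. (inverse (real (Suc N)))\<^sup>2 / ((inverse (real (Suc N)))\<^sup>2 + (s - \<alpha>)\<^sup>2))
          \<longlonglongrightarrow> 0\<^sup>2 / (0\<^sup>2 + (s - \<alpha>)\<^sup>2)"
        using False by (intro tendsto_intros LIMSEQ_inverse_real_of_nat) auto
      ultimately show ?thesis using False by simp
    qed (simp add: w_def)
    obtain D where D: "\<And>x. \<bar>q' x\<bar> \<le> D" using bounded_mem[OF q'] by blast
    \<comment> \<open>Integration by parts: the derivative \<open>u + v\<close> of the product
      \<open>h\<close> has integral 0, so the derivative can be moved from \<open>F N\<close> to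
      \<open>q\<close>.\<close>
    have ibp: "(LINT z|m. w N (\<Phi> f z) * (\<Phi> g z * \<Phi> q z)) = - (LINT z|m. F N (\<Phi> f z) * \<Phi> q' z)" for N
    proof -
      define h where "h = (\<lambda>x. F N (f x) * q x)"
      define u where "u = (\<lambda>x. w N (f x) * (g x * q x))"
      define v where "v = (\<lambda>x. F N (f x) * q' x)"
      have mem: "h \<in> A" "u \<in> A" "v \<in> A"
        unfolding h_def u_def v_def by (intro mult_mem FA wA q q' g)+
      have F_der: "(F N has_real_derivative w N s) (at s)" for s
        unfolding F_def w_def
        by (auto intro!: derivative_eq_intros simp: field_simps add_nonneg_eq_0_iff)
      have "((\<lambda>t. h (x + t *\<^sub>R e)) has_real_derivative u x + v x) (at 0)" for x
      proof -
        have "((\<lambda>t. F N (f (x + t *\<^sub>R e))) has_real_derivative w N (f x) * g x) (at 0)"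
          using DERIV_chain2[OF _ der, of "F N"] F_der[of "f x"] by simp
        from DERIV_mult[OF this q_der[of x]] show ?thesis
          by (simp add: h_def u_def v_def algebra_simps)
      qed
      from integral_derivative_eq_0[OF mem(1) add_mem[OF mem(2,3)] this]
      have "0 = (LINT z|m. \<Phi> (\<lambda>x. u x + v x) z)" by simp
      also have "\<dots> = (LINT z|m. \<Phi> u z + \<Phi> v z)"
        by (intro Bochner_Integration.integral_cong) (auto simp: space_m rep_add mem)
      also have "\<dots> = (LINT z|m. \<Phi> u z) + (LINT z|m. \<Phi> v z)"
        by (intro Bochner_Integration.integral_add rep_integrable mem)
      also have "(LINT z|m. \<Phi> u z) = (LINT z|m. w N (\<Phi> f z) * (\<Phi> g z * \<Phi> q z))"
        by (intro Bochner_Integration.integral_cong)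
          (auto simp: space_m u_def rep_mult wA g q mult_mem functional_calculus_rep[OF w_cont f])
      also have "(LINT z|m. \<Phi> v z) = (LINT z|m. F N (\<Phi> f z) * \<Phi> q' z)"
        by (intro Bochner_Integration.integral_cong)
          (auto simp: space_m v_def rep_mult FA q' functional_calculus_rep[OF F_cont f])
      finally show ?thesis by simp
    qed
    have "(\<lambda>N. LINT z|m. w N (\<Phi> f z) * (\<Phi> g z * \<Phi> q z)) \<longlonglongrightarrow> 0"
    proof (rule Lim_null_comparison)
      have "norm (LINT z|m. w N (\<Phi> f z) * (\<Phi> g z * \<Phi> q z)) \<le> 2 / real (Suc N) * D" for N
      proof -
        have int: "integrable m (\<lambda>z. F N (\<Phi> f z) * \<Phi> q' z)"
          using rep_integrable[OF mult_mem[OF FA q']]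
          by (rule Bochner_Integration.integrable_cong[THEN iffD1, rotated -1])
            (auto simp: space_m rep_mult FA q' functional_calculus_rep[OF F_cont f])
        have "\<bar>LINT z|m. F N (\<Phi> f z) * \<Phi> q' z\<bar> \<le> (LINT z|m. \<bar>F N (\<Phi> f z) * \<Phi> q' z\<bar>)"
          by (rule integral_abs_bound)
        also have "\<dots> \<le> 2 / real (Suc N) * D"
        proof (rule integral_le_const)
          show "AE z in m. \<bar>F N (\<Phi> f z) * \<Phi> q' z\<bar> \<le> 2 / real (Suc N) * D"
            unfolding abs_mult
            by (intro AE_I2 mult_mono F_bound rep_bound[OF q' D]) (auto simp: space_m)
        qed (use int in simp)
        finally show ?thesis by (simp add: ibp)
      qed
      then show "\<forall>\<^sub>F N in sequentially. norm (LINT z|m. w N (\<Phi> f z) * (\<Phi> g z * \<Phi> q z)) \<le> 2 / real (Suc N) * D"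
        by simp
      show "(\<lambda>N. 2 / real (Suc N) * D) \<longlonglongrightarrow> 0"
        using tendsto_mult[OF LIMSEQ_inverse_real_of_nat tendsto_const, of "2 * D"]
        by (simp add: divide_inverse mult.commute mult.left_commute)
    qed
    \<comment> \<open>The discontinuous weight \<open>I\<close> need not come from \<open>A\<close>;
      it is reached by dominated convergence from the continuous weights \<open>w N\<close>.\<close>
    moreover have "(\<lambda>N. LINT z|m. w N (\<Phi> f z) * (\<Phi> g z * \<Phi> q z))
        \<longlonglongrightarrow> (LINT z|m. I z * (\<Phi> g z * \<Phi> q z))"
    proof (rule integral_dominated_convergence[where w = "\<lambda>z. \<bar>\<Phi> (\<lambda>x. g x * q x) z\<bar>"])
      show "(\<lambda>z. I z * (\<Phi> g z * \<Phi> q z)) \<in> borel_measurable m"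
        using I_int[OF g q] by (rule borel_measurable_integrable)
      have "w N \<in> borel_measurable borel" for N
        using w_cont by (rule borel_measurable_continuous_onI)
      then show "(\<lambda>z. w N (\<Phi> f z) * (\<Phi> g z * \<Phi> q z)) \<in> borel_measurable m" for N
        by (intro borel_measurable_times rep_measurable g q measurable_compose[OF rep_measurable[OF f]])
      show "integrable m (\<lambda>z. \<bar>\<Phi> (\<lambda>x. g x * q x) z\<bar>)"
        by (intro integrable_abs rep_integrable mult_mem g q)
      show "AE z in m. (\<lambda>N. w N (\<Phi> f z) * (\<Phi> g z * \<Phi> q z)) \<longlonglongrightarrow> I z * (\<Phi> g z * \<Phi> q z)"
        using w_lim by (intro AE_I2 tendsto_intros) (auto simp: I_def indicator_def)
      show "AE z in m. norm (w N (\<Phi> f z) * (\<Phi> g z * \<Phi> q z)) \<le> \<bar>\<Phi> (\<lambda>x. g x * q x) z\<bar>" for N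
        using w_bound by (intro AE_I2)
          (auto simp: space_m rep_mult g q abs_mult intro!: mult_left_le_one_le)
    qed
    ultimately show ?thesis by (rule LIMSEQ_unique[symmetric])
  qed
  have "(LINT z|m. I z * (\<Phi> g z * \<Phi> g z)) \<le> 0 + \<epsilon>" if "\<epsilon> > 0" for \<epsilon>
  proof -
    \<comment> \<open>The error g - q will be multiplied by \<open>g\<close>, of size at most
      \<open>C\<close>; the summand 1 covers \<open>C = 0\<close>.\<close>
    have \<epsilon>: "\<epsilon> / (C + 1) > 0" using that C0 by simp
    \<comment> \<open>The difference quotient of \<open>f\<close> replaces \<open>g\<close>, which need not be differentiable:
      it is uniformly close to \<open>g\<close> and differentiable along \<open>e\<close> with derivative in \<open>A\<close>.\<close>
    obtain \<eta> where \<eta>: "\<eta> > 0" "\<And>x. \<bar>(f (x + \<eta> *\<^sub>R e) - f x) / \<eta> - g x\<bar> \<le> \<epsilon> / (C + 1)"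
      using difference_quotient_uniform[OF uniformly_continuous_mem[OF g] der \<epsilon>] by blast
    define q where "q = (\<lambda>x. (f (x + \<eta> *\<^sub>R e) - f x) / \<eta>)"
    have q: "q \<in> A" unfolding q_def by (rule difference_quotient_mem[OF f])
    have "((\<lambda>t. q (x + t *\<^sub>R e)) has_real_derivative (g (x + \<eta> *\<^sub>R e) - g x) / \<eta>) (at 0)" for x
      using DERIV_cdivide[OF DERIV_diff[OF der[of "x + \<eta> *\<^sub>R e"] der[of x]], of \<eta>]
      by (simp add: q_def algebra_simps)
    \<comment> \<open>The subtracted integral is 0 by \<open>orth\<close>, which leaves
      \<open>g\<close> times the small error g - q on the level set.\<close>
    from orth[OF q difference_quotient_mem[OF g] this]
    have "(LINT z|m. I z * (\<Phi> g z * \<Phi> g z))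
        = (LINT z|m. I z * (\<Phi> g z * \<Phi> g z) - I z * (\<Phi> g z * \<Phi> q z))"
      by (simp add: I_int g q)
    also have "\<dots> \<le> \<epsilon>"
    proof (rule integral_le_const)
      show "AE z in m. I z * (\<Phi> g z * \<Phi> g z) - I z * (\<Phi> g z * \<Phi> q z) \<le> \<epsilon>"
      proof (rule AE_I2)
        fix z assume "z \<in> space m"
        then have z: "z \<in> topspace X" by (simp add: space_m)
        have "\<Phi> g z * (\<Phi> g z - \<Phi> q z) \<le> \<bar>\<Phi> g z\<bar> * \<bar>\<Phi> g z - \<Phi> q z\<bar>"
          by (metis abs_ge_self abs_mult)
        also have "\<dots> \<le> C * (\<epsilon> / (C + 1))"
          using rep_bound[OF g C z] rep_diff_bound[OF g q _ z, of "\<epsilon> / (C + 1)"] \<eta>(2) C0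
          by (intro mult_mono) (auto simp: q_def abs_minus_commute)
        also have "\<dots> \<le> \<epsilon>"
          using C0 that by (simp add: field_simps)
        finally show "I z * (\<Phi> g z * \<Phi> g z) - I z * (\<Phi> g z * \<Phi> q z) \<le> \<epsilon>"
          using that by (auto simp: I_def indicator_def algebra_simps)
      qed
    qed (intro Bochner_Integration.integrable_diff I_int g q)
    finally show ?thesis by simp
  qed
  then have "(LINT z|m. I z * (\<Phi> g z * \<Phi> g z)) \<le> 0"
    by (rule field_le_epsilon)
  moreover have nonneg: "0 \<le> I z * (\<Phi> g z * \<Phi> g z)" for z
    by (simp add: I_def)
  ultimately have "(LINT z|m. I z * (\<Phi> g z * \<Phi> g z)) = 0"
    by (intro antisym Bochner_Integration.integral_nonneg)
  then have "AE z in m. I z * (\<Phi> g z * \<Phi> g z) = 0"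
    using integral_nonneg_eq_0_iff_AE[OF I_int[OF g g]] nonneg by simp
  then show ?thesis
    by eventually_elim (auto simp: I_def)
qed

section \<open>Gradients and null level sets\<close>

lemma sum_squares_rep:
  assumes "\<And>i. u i \<in> A" and "finite J"
  shows "(\<lambda>x. \<Sum>i\<in>J. (u i x)\<^sup>2) \<in> A \<and>
    (\<forall>z\<in>topspace X. \<Phi> (\<lambda>x. \<Sum>i\<in>J. (u i x)\<^sup>2) z = (\<Sum>i\<in>J. (\<Phi> (u i) z)\<^sup>2))"
  using assms(2)
proof induction
  case (insert i J)
  have "(\<lambda>x. (u i x)\<^sup>2) \<in> A" "\<forall>z\<in>topspace X. \<Phi> (\<lambda>x. (u i x)\<^sup>2) z = (\<Phi> (u i) z)\<^sup>2"
    using mult_mem[OF assms(1) assms(1), of i i] rep_mult[OF _ assms(1) assms(1), of _ i i]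
    by (simp_all add: power2_eq_square)
  with insert show ?case by (simp add: add_mem rep_add)
qed (simp_all add: const_mem rep_const)

lemma grad_norm_mem:
  assumes "\<And>i. partial i f \<in> A"
  shows "grad_norm f \<in> A"
proof -
  have "(\<lambda>x. \<Sum>i\<in>UNIV. (partial i f x)\<^sup>2) \<in> A"
    using sum_squares_rep[of "\<lambda>i. partial i f", OF assms finite_class.finite_UNIV] by blast
  \<comment> \<open>\<open>sqrt\<close> is total and continuous on all of the reals, so the
    functional calculus applies although \<open>sqrt\<close> is not differentiable at 0.\<close>
  from functional_calculus_mem[OF continuous_on_real_sqrt[OF continuous_on_id] this] show ?thesis
    by (simp add: grad_norm_def[abs_def])
qed

lemma grad_norm_rep:
  assumes "\<And>i. partial i f \<in> A" and z: "z \<in> topspace X"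
  shows "\<Phi> (grad_norm f) z = sqrt (\<Sum>i\<in>UNIV. (\<Phi> (partial i f) z)\<^sup>2)"
proof -
  note S = sum_squares_rep[of "\<lambda>i. partial i f", OF assms(1) finite_class.finite_UNIV]
  have "\<Phi> (\<lambda>x. sqrt (\<Sum>i\<in>UNIV. (partial i f x)\<^sup>2)) z = sqrt (\<Phi> (\<lambda>x. \<Sum>i\<in>UNIV. (partial i f x)\<^sup>2) z)"
    using S by (intro functional_calculus_rep[OF _ _ z] continuous_on_real_sqrt continuous_on_id) auto
  then show ?thesis using S z by (simp add: grad_norm_def[abs_def])
qed

lemma grad_norm_rep_eq_0_iff:
  assumes "\<And>i. partial i f \<in> A" and "z \<in> topspace X"
  shows "\<Phi> (grad_norm f) z = 0 \<longleftrightarrow> (\<forall>i. \<Phi> (partial i f) z = 0)"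
  by (simp add: grad_norm_rep[OF assms] sum_nonneg_eq_0_iff)

lemma gradient_zero_on_level_set:
  assumes "f \<in> A" and "\<And>i. partially_differentiable i f" and "\<And>i. partial i f \<in> A"
  shows "AE z in m. \<Phi> f z = \<alpha> \<longrightarrow> (\<forall>i. \<Phi> (partial i f) z = 0)"
proof -
  \<comment> \<open>The index type is finite, so the exceptional null sets of the single directions
    can be united.\<close>
  have "AE z in m. \<forall>i. \<Phi> f z = \<alpha> \<longrightarrow> \<Phi> (partial i f) z = 0"
    unfolding AE_all_countable
    using derivative_zero_on_level_set[OF assms(1,3) partially_differentiable_DERIV[OF assms(2)]] by blast
  then show ?thesis by eventually_elim auto
qed

lemma emeasure_level_set_eq_0_iff:
  assumes "f \<in> A"
  shows "emeasure m {z \<in> topspace X. \<Phi> f z = \<alpha>} = 0 \<longleftrightarrow> (AE z in m. \<Phi> f z \<noteq> \<alpha>)"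
  using AE_iff_measurable[of "{z \<in> topspace X. \<Phi> f z = \<alpha>}" m "\<lambda>z. \<Phi> f z \<noteq> \<alpha>"] level_set_sets[OF assms]
  by (simp add: space_m)

text \<open>Strong regularity passes to the compact space as a weak inequality with the same
  \<delta>, so \<open>\<Phi> f = \<alpha>\<close> and a vanishing gradient exclude each other at
  every point. Almost everywhere on the level set the gradient does vanish, so that set is
  null.\<close>

lemma strongly_regular_level_set_null:
  assumes f: "f \<in> A" and "\<And>i. partially_differentiable i f" and d: "\<And>i. partial i f \<in> A"
    and "strongly_regular_value f \<alpha>"
  shows "emeasure m {z \<in> topspace X. \<Phi> f z = \<alpha>} = 0"
proof -
  obtain \<delta> where \<delta>: "\<delta> > 0" "\<And>x. \<bar>f x - \<alpha>\<bar>\<^sup>2 + (grad_norm f x)\<^sup>2 > \<delta>"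
    using assms(4) unfolding strongly_regular_value_def by blast
  define S where "S = (\<lambda>x. \<Sum>i\<in>UNIV. (partial i f x)\<^sup>2)"
  have S: "S \<in> A" "\<And>z. z \<in> topspace X \<Longrightarrow> \<Phi> S z = (\<Sum>i\<in>UNIV. (\<Phi> (partial i f) z)\<^sup>2)"
    using sum_squares_rep[of "\<lambda>i. partial i f", OF d finite_class.finite_UNIV] by (auto simp: S_def)
  \<comment> \<open>The constant \<delta> is absorbed into the function applied to \<open>f\<close>,
    so that the regularity condition becomes nonnegativity of a sum of two elements of
    \<open>A\<close>.\<close>
  have sq_cont: "continuous_on UNIV (\<lambda>s. (s - \<alpha>)\<^sup>2 - \<delta>)"
    by (intro continuous_intros)
  note sq = functional_calculus[OF sq_cont f]
  have "(\<Phi> f z - \<alpha>)\<^sup>2 - \<delta> + (\<Sum>i\<in>UNIV. (\<Phi> (partial i f) z)\<^sup>2) \<ge> 0" if z: "z \<in> topspace X" for z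
  proof -
    have "0 \<le> (f x - \<alpha>)\<^sup>2 - \<delta> + S x" for x
      using \<delta>(2)[of x] by (simp add: S_def grad_norm_square)
    from rep_nonneg[OF add_mem[OF sq(1) S(1)] this z] show ?thesis
      using rep_add[OF z sq(1) S(1)] sq(2)[OF z] S(2)[OF z] by simp
  qed
  then have "\<not> (\<Phi> f z = \<alpha> \<and> (\<forall>i. \<Phi> (partial i f) z = 0))" if "z \<in> topspace X" for z
    using that \<delta>(1) by fastforce
  then have "AE z in m. \<not> (\<Phi> f z = \<alpha> \<and> (\<forall>i. \<Phi> (partial i f) z = 0))"
    by (intro AE_I2) (simp add: space_m)
  with gradient_zero_on_level_set[OF assms(1-3), of \<alpha>] have "AE z in m. \<Phi> f z \<noteq> \<alpha>"
    by eventually_elim auto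
  then show ?thesis by (simp add: emeasure_level_set_eq_0_iff[OF f])
qed

text \<open>Up to a null set, the level set lies in the zero set of the gradient.\<close>

lemma level_set_null_if_gradient_null:
  assumes "f \<in> A" and "\<And>i. partially_differentiable i f" and d: "\<And>i. partial i f \<in> A"
    and "emeasure m {z \<in> topspace X. \<Phi> (grad_norm f) z = 0} = 0"
  shows "emeasure m {z \<in> topspace X. \<Phi> f z = \<alpha>} = 0"
proof -
  have "AE z in m. \<Phi> (grad_norm f) z \<noteq> 0"
    using assms(4) by (simp add: emeasure_level_set_eq_0_iff grad_norm_mem d)
  with gradient_zero_on_level_set[OF assms(1-3), of \<alpha>] AE_space have "AE z in m. \<Phi> f z \<noteq> \<alpha>"
    by eventually_elim (auto simp: space_m grad_norm_rep_eq_0_iff[OF d])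
  then show ?thesis by (simp add: emeasure_level_set_eq_0_iff assms(1))
qed

end

theorem lemma2p3:
  fixes A :: "(real^'n \<Rightarrow> real) set"
    and X :: "'k topology"
    and \<Phi> :: "(real^'n \<Rightarrow> real) \<Rightarrow> 'k \<Rightarrow> real"
    and m :: "'k measure"
    and \<psi> :: "real^'n \<Rightarrow> real"
  assumes "algebra_with_mean_value A"
    and "associated_space A X \<Phi> m"
    and "\<psi> \<in> A"
    and "\<And>i. partially_differentiable i \<psi>"
    and "\<And>i. partial i \<psi> \<in> A"
    and "\<And>i j. partially_differentiable i (partial j \<psi>)"
    and "\<And>i j. partial i (partial j \<psi>) \<in> A"
  shows "(\<forall>\<alpha>. strongly_regular_value \<psi> \<alpha> \<longrightarrow>
            emeasure m {z \<in> topspace X. \<Phi> \<psi> z = \<alpha>} = 0) \<and>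
         (emeasure m {z \<in> topspace X. \<Phi> (grad_norm \<psi>) z = 0} = 0 \<longrightarrow>
            (\<forall>\<alpha>. emeasure m {z \<in> topspace X. \<Phi> \<psi> z = \<alpha>} = 0)) \<and>
         ((\<exists>k. strongly_regular_value (partial k \<psi>) 0) \<longrightarrow>
            emeasure m {z \<in> topspace X. \<Phi> (grad_norm \<psi>) z = 0} = 0 \<and>
            (\<forall>\<alpha>. emeasure m {z \<in> topspace X. \<Phi> \<psi> z = \<alpha>} = 0))"
proof -
  interpret associated_mean_value_space A X \<Phi> m
    using assms(1,2) by (rule associated_mean_value_space.intro)
  \<comment> \<open>The second derivatives enter here: part (i) is applied to
    \<open>partial k \<psi>\<close> at the value 0, whose level set contains the zero set of the
    gradient.\<close>
  have grad_null: "emeasure m {z \<in> topspace X. \<Phi> (grad_norm \<psi>) z = 0} = 0"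
    if "strongly_regular_value (partial k \<psi>) 0" for k
  proof -
    have "{z \<in> topspace X. \<Phi> (grad_norm \<psi>) z = 0} \<subseteq> {z \<in> topspace X. \<Phi> (partial k \<psi>) z = 0}"
      by (auto simp: grad_norm_rep_eq_0_iff[OF assms(5)])
    from emeasure_mono[OF this level_set_sets[OF assms(5)]] show ?thesis
      using strongly_regular_level_set_null[OF assms(5,6,7) that] by simp
  qed
  show ?thesis
    using strongly_regular_level_set_null[OF assms(3-5)]
      level_set_null_if_gradient_null[OF assms(3-5)] grad_null by blast
qed

end
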